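(* Let $X$ be a Tychonoff space and let $0<q<\infty$. There is no continuous linear surjection $C_p(X)\to(\ell_q)_p$.
   Context: All vector spaces are real. For a Tychonoff (completely regular Hausdorff) space $X$, $C_p(X)$ is the vector space $C(X)$ of all continuous real-valued functions on $X$ with the topology of pointwise convergence. For $0<q<\infty$, $\ell_q$ is the vector space of real sequences $(x_n)_{n\in\mathbb{N}}$ with $\sum_n|x_n|^q<\infty$, and $(\ell_q)_p$ denotes $\ell_q$ with the subspace topology inherited from the product space $\mathbb{R}^{\mathbb{N}}$ (not the norm or quasi-norm topology). *)

theory Defs
  imports "HOL-Analysis.Analysis"
begin

definition Tychonoff_space :: "'a topology \<Rightarrow> bool" where
  "Tychonoff_space X \<longleftrightarrow> completely_regular_space X \<and> Hausdorff_space X"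

text \<open>
  The real power \<open>powertop_real I\<close> consists of the functions that are \<open>undefined\<close> outside \<open>I\<close>,
  so the pointwise vector space operations have to be restricted to \<open>I\<close>.
\<close>

definition pointwise_add :: "'i set \<Rightarrow> ('i \<Rightarrow> real) \<Rightarrow> ('i \<Rightarrow> real) \<Rightarrow> 'i \<Rightarrow> real" where
  "pointwise_add I f g = (\<lambda>i\<in>I. f i + g i)"

definition pointwise_scale :: "'i set \<Rightarrow> real \<Rightarrow> ('i \<Rightarrow> real) \<Rightarrow> 'i \<Rightarrow> real" where
  "pointwise_scale I c f = (\<lambda>i\<in>I. c * f i)"

text \<open>Linearity on \<open>V\<close>, a linear subspace of the power over \<open>I\<close>, with values in the power over \<open>J\<close>.\<close>

definition pointwise_linear_on ::
    "'i set \<Rightarrow> ('i \<Rightarrow> real) set \<Rightarrow> 'j set \<Rightarrow> (('i \<Rightarrow> real) \<Rightarrow> 'j \<Rightarrow> real) \<Rightarrow> bool" where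
  "pointwise_linear_on I V J T \<longleftrightarrow>
     (\<forall>f\<in>V. \<forall>g\<in>V. T (pointwise_add I f g) = pointwise_add J (T f) (T g)) \<and>
     (\<forall>c. \<forall>f\<in>V. T (pointwise_scale I c f) = pointwise_scale J c (T f))"

definition Cp :: "'a topology \<Rightarrow> ('a \<Rightarrow> real) topology" where
  "Cp X = subtopology (powertop_real (topspace X)) {f. continuous_map X euclideanreal f}"

definition ell :: "real \<Rightarrow> (nat \<Rightarrow> real) set" where
  "ell q = {x. summable (\<lambda>n. \<bar>x n\<bar> powr q)}"

definition ell_p :: "real \<Rightarrow> (nat \<Rightarrow> real) topology" where
  "ell_p q = subtopology (powertop_real UNIV) (ell q)"

lemma topspace_Cp:
  "topspace (Cp X) = {f \<in> extensional (topspace X). continuous_map X euclideanreal f}"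
  by (auto simp: Cp_def PiE_def)

lemma topspace_ell_p: "topspace (ell_p q) = ell q"
  by (auto simp: ell_p_def)

lemma pointwise_add_Cp:
  assumes "f \<in> topspace (Cp X)" "g \<in> topspace (Cp X)"
  shows "pointwise_add (topspace X) f g \<in> topspace (Cp X)"
proof -
  have "continuous_map X euclideanreal (\<lambda>x. f x + g x)"
    using assms by (auto simp: topspace_Cp intro: continuous_map_add)
  then show ?thesis
    by (auto simp: topspace_Cp pointwise_add_def elim: continuous_map_eq)
qed

lemma pointwise_scale_Cp:
  assumes "f \<in> topspace (Cp X)"
  shows "pointwise_scale (topspace X) c f \<in> topspace (Cp X)"
proof -
  have "continuous_map X euclideanreal (\<lambda>x. c * f x)"
    using assms by (auto simp: topspace_Cp intro: continuous_map_real_mult_left)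
  then show ?thesis
    by (auto simp: topspace_Cp pointwise_scale_def elim: continuous_map_eq)
qed

end

theory Submission
  imports Defs
begin

text \<open>
  Write \<open>T f n = \<mu>\<^sub>n(f)\<close>. Each \<open>\<mu>\<^sub>n\<close> is a continuous functional for the pointwise topology, hence a finite
  linear combination of point evaluations (\<open>Cp_functional_eq_pairing\<close>). So the question is
  whether finitely supported signed measures \<open>\<mu>\<^sub>n\<close> can have \<open>(\<mu>\<^sub>n(f))\<^sub>n \<in> ell q\<close> for every continuous \<open>f\<close>
  and realise every element of \<open>ell q\<close> in this way. Baire's theorem on the Banach space of bounded
  continuous functions gives a bound \<open>C\<close> with \<open>(\<Sum>n<N. \<bar>\<mu>\<^sub>n(g)\<bar> powr q) \<le> C\<close> for all \<open>N\<close> and all continuous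
  \<open>g\<close> with \<open>\<bar>g\<bar> \<le> 1\<close> (\<open>uniformly_bounded\<close>). The values of such a \<open>g\<close> on a finite set can be prescribed
  freely in \<open>[-1, 1]\<close>, and finite supports see nothing else; this gives three consequences.

  \<^item> Every continuous \<open>f\<close> is bounded on the union of the supports (\<open>bounded_on_supports\<close>). If not,
    multiply the measures by a weight that is a fast growing function of \<open>\<bar>f\<bar>\<close>: the weighted measures
    satisfy the same hypotheses, but have arbitrarily large atoms.

  \<^item> By surjectivity, the total variations of the \<open>\<mu>\<^sub>n\<close> stay eventually above some \<open>c > 0\<close>
    (\<open>variation_eventually_ge\<close>). If they were below \<open>(1/4) ^ k\<close> along a subsequence \<open>r\<close>, no \<open>f\<close>
    bounded on the supports could take the value \<open>(1/2) ^ k\<close> at \<open>\<mu>\<close> with index \<open>r k\<close> for all \<open>k\<close>,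
    although this prescription is a sequence in \<open>ell q\<close>.

  \<^item> The mass of each single point tends to \<open>0\<close> along the sequence (\<open>atoms_tendsto_zero\<close>). Hence
    one can pick any number \<open>N\<close> of measures that are almost disjoint, and a single function with
    values in \<open>[-1, 1]\<close> at which each of them is at least \<open>c / 2\<close> (\<open>simultaneous_norming\<close>).

  The last function gives \<open>N * (c / 2) powr q \<le> C\<close> for every \<open>N\<close>, a contradiction. For spaces of
  sequences that merely tend to \<open>0\<close> the last step fails, and such quotients do exist: it is the
  summability that turns many large coordinates into a large sum.
\<close>


section \<open>Interpolation on finite sets\<close>

lemma Tychonoff_peak:
  assumes "Tychonoff_space X" "finite F" "F \<subseteq> topspace X" "x \<in> topspace X"
  obtains h :: "'a \<Rightarrow> real" where "continuous_map X euclideanreal h"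
    "h x = 1" "\<And>y. y \<in> F - {x} \<Longrightarrow> h y = 0"
proof -
  have "closedin X (F - {x})"
    using assms closedin_Hausdorff_finite[of X "F - {x}"] by (auto simp: Tychonoff_space_def)
  then obtain f where f: "continuous_map X euclideanreal f" "f x = 0" "f ` (F - {x}) \<subseteq> {1}"
    using assms unfolding Tychonoff_space_def completely_regular_space_alt by blast
  show thesis
  proof (rule that[of "\<lambda>y. 1 - f y"])
    show "continuous_map X euclideanreal (\<lambda>y. 1 - f y)"
      by (intro continuous_map_diff f) auto
  qed (use f in auto)
qed

text \<open>
  The combination of peak functions with the prescribed values is truncated to \<open>[-1, 1]\<close>, which does not
  change its values on \<open>F\<close>.
\<close>

lemma Tychonoff_finite_interpolation:
  fixes v :: "'a \<Rightarrow> real"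
  assumes "Tychonoff_space X" "finite F" "F \<subseteq> topspace X" "\<And>x. x \<in> F \<Longrightarrow> \<bar>v x\<bar> \<le> 1"
  obtains g where "continuous_map X euclideanreal g" "\<And>x. \<bar>g x\<bar> \<le> 1" "\<And>x. x \<in> F \<Longrightarrow> g x = v x"
proof -
  have "\<exists>h. continuous_map X euclideanreal h \<and> h x = 1 \<and> (\<forall>y \<in> F - {x}. h y = 0)"
    if "x \<in> F" for x
  proof (rule Tychonoff_peak[OF assms(1-3)])
    show "x \<in> topspace X" using assms(3) that by auto
  qed blast
  then obtain h where "\<forall>x\<in>F. continuous_map X euclideanreal (h x) \<and> h x x = 1 \<and> (\<forall>y \<in> F - {x}. h x y = 0)"
    using bchoice[of F "\<lambda>x h. continuous_map X euclideanreal h \<and> h x = 1 \<and> (\<forall>y \<in> F - {x}. h y = 0)"] by blast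
  then have h: "\<And>x. x \<in> F \<Longrightarrow> continuous_map X euclideanreal (h x)"
    "\<And>x. x \<in> F \<Longrightarrow> h x x = 1" "\<And>x y. x \<in> F \<Longrightarrow> y \<in> F \<Longrightarrow> y \<noteq> x \<Longrightarrow> h x y = 0"
    by auto
  define g where "g = (\<lambda>y. \<Sum>x\<in>F. v x * h x y)"
  have val: "g y = v y" if "y \<in> F" for y
  proof -
    have "g y = (\<Sum>x\<in>F. if x = y then v x else 0)"
      unfolding g_def using that h by (intro sum.cong) auto
    then show ?thesis using that assms(2) by simp
  qed
  show thesis
  proof (rule that[of "\<lambda>y. max (-1) (min 1 (g y))"])
    have "continuous_map X euclideanreal g"
      unfolding g_def by (intro continuous_map_sum continuous_map_real_mult_left h assms) auto
    then show "continuous_map X euclideanreal (\<lambda>y. max (-1) (min 1 (g y)))"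
      by (intro continuous_map_real_max continuous_map_real_min) auto
    show "max (- 1) (min 1 (g x)) = v x" if "x \<in> F" for x
      using assms(4)[OF that] val[OF that] by (auto simp: abs_le_iff)
  qed (auto simp: abs_le_iff)
qed

section \<open>Finitely supported measures\<close>

definition pairing :: "('a \<Rightarrow> real) \<Rightarrow> ('a \<Rightarrow> real) \<Rightarrow> real" where
  "pairing \<mu> f = (\<Sum>x | \<mu> x \<noteq> 0. \<mu> x * f x)"

definition variation :: "('a \<Rightarrow> real) \<Rightarrow> real" where
  "variation \<mu> = (\<Sum>x | \<mu> x \<noteq> 0. \<bar>\<mu> x\<bar>)"

lemma pairing_superset:
  assumes "finite F" "{x. \<mu> x \<noteq> 0} \<subseteq> F"
  shows "pairing \<mu> f = (\<Sum>x\<in>F. \<mu> x * f x)"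
  unfolding pairing_def using assms by (intro sum.mono_neutral_left) auto

lemma pairing_cong:
  assumes "\<And>x. \<mu> x \<noteq> 0 \<Longrightarrow> f x = g x"
  shows "pairing \<mu> f = pairing \<mu> g"
  unfolding pairing_def using assms by (intro sum.cong) auto

lemma pairing_linear: "pairing \<mu> (\<lambda>x. a * f x + b * g x) = a * pairing \<mu> f + b * pairing \<mu> g"
  unfolding pairing_def by (simp add: sum.distrib sum_distrib_left algebra_simps)

lemma pairing_single:
  assumes "finite {x. \<mu> x \<noteq> 0}" "\<And>y. \<mu> y \<noteq> 0 \<Longrightarrow> y \<noteq> x \<Longrightarrow> f y = 0"
  shows "pairing \<mu> f = \<mu> x * f x"
proof -
  have "pairing \<mu> f = (\<Sum>y\<in>insert x {x. \<mu> x \<noteq> 0}. \<mu> y * f y)"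
    using assms by (intro pairing_superset) auto
  also have "\<dots> = (\<Sum>y\<in>{x}. \<mu> y * f y)"
    using assms by (intro sum.mono_neutral_right) auto
  finally show ?thesis by simp
qed

lemma pairing_mult_measure:
  assumes "finite {x. \<mu> x \<noteq> 0}"
  shows "pairing (\<lambda>x. w x * \<mu> x) f = pairing \<mu> (\<lambda>x. w x * f x)"
proof -
  have "pairing (\<lambda>x. w x * \<mu> x) f = (\<Sum>x | \<mu> x \<noteq> 0. w x * \<mu> x * f x)"
    using assms by (intro pairing_superset) auto
  then show ?thesis
    by (simp add: pairing_def algebra_simps)
qed

lemma abs_pairing_le:
  assumes "\<And>x. \<mu> x \<noteq> 0 \<Longrightarrow> \<bar>f x\<bar> \<le> M"
  shows "\<bar>pairing \<mu> f\<bar> \<le> variation \<mu> * M"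
proof -
  have "\<bar>pairing \<mu> f\<bar> \<le> (\<Sum>x | \<mu> x \<noteq> 0. \<bar>\<mu> x * f x\<bar>)"
    unfolding pairing_def by (rule sum_abs)
  also have "\<dots> \<le> (\<Sum>x | \<mu> x \<noteq> 0. \<bar>\<mu> x\<bar> * M)"
    using assms by (intro sum_mono) (auto simp: abs_mult intro: mult_left_mono)
  finally show ?thesis by (simp add: variation_def sum_distrib_right)
qed

text \<open>
  The setting for the rest of the argument: the map \<open>f \<mapsto> (\<mu>\<^sub>n(f))\<^sub>n\<close> into \<open>ell q\<close>, without surjectivity.
  It is stable under multiplication by a continuous weight.
\<close>

locale ell_measures =
  fixes X :: "'a topology" and q :: real and \<mu> :: "nat \<Rightarrow> 'a \<Rightarrow> real"
  assumes Tychonoff: "Tychonoff_space X"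
    and q_pos: "0 < q"
    and finite_support: "finite {x. \<mu> n x \<noteq> 0}"
    and support_in_space: "\<mu> n x \<noteq> 0 \<Longrightarrow> x \<in> topspace X"
    and pairings_in_ell: "continuous_map X euclideanreal f \<Longrightarrow> (\<lambda>n. pairing (\<mu> n) f) \<in> ell q"
begin

section \<open>Uniform boundedness\<close>

lemma diff_powr_le:
  fixes a b :: real
  shows "\<bar>a - b\<bar> powr q \<le> 2 powr q * (\<bar>a\<bar> powr q + \<bar>b\<bar> powr q)"
proof -
  have "\<bar>a - b\<bar> powr q \<le> (2 * max \<bar>a\<bar> \<bar>b\<bar>) powr q"
    using q_pos by (intro powr_mono2) auto
  also have "\<dots> = 2 powr q * max \<bar>a\<bar> \<bar>b\<bar> powr q"
    by (simp add: powr_mult)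
  also have "\<dots> \<le> 2 powr q * (\<bar>a\<bar> powr q + \<bar>b\<bar> powr q)"
    by (intro mult_left_mono) (auto simp: max_def)
  finally show ?thesis .
qed

text \<open>
  This replaces the closed graph theorem. The bounded continuous functions whose image has \<open>q\<close>-sum at most
  \<open>k\<close> form a closed set, because every functional reads finitely many points. By Baire's theorem one
  of these sets contains a ball, and a \<open>g\<close> with \<open>\<bar>g\<bar> \<le> 1\<close> is a multiple of the difference of two
  elements of the ball.
\<close>

lemma uniformly_bounded:
  obtains C where "\<And>g N. continuous_map X euclideanreal g \<Longrightarrow> (\<And>x. x \<in> topspace X \<Longrightarrow> \<bar>g x\<bar> \<le> 1)
    \<Longrightarrow> (\<Sum>n<N. \<bar>pairing (\<mu> n) g\<bar> powr q) \<le> C"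
proof -
  define m where "m = cfunspace X (euclidean_metric :: real metric)"
  interpret B: Metric_space "mspace m" "mdist m"
    by (rule Metric_space_mspace_mdist)
  have complete: "B.mcomplete"
    using Met_TC.mcomplete_cfunspace[of X] complete_UNIV
    by (simp add: m_def mcomplete_of_def euclidean_metric_def Met_TC.Self_def)
  have mspace: "f \<in> mspace m \<longleftrightarrow> f \<in> extensional (topspace X) \<and> bounded (f ` topspace X) \<and>
      continuous_map X euclideanreal f" for f
    by (auto simp: m_def)
  have le: "\<bar>f x - g x\<bar> \<le> a" if "f \<in> mspace m" "g \<in> mspace m" "mdist m f g \<le> a" "x \<in> topspace X"
    for f g x a
    using mdist_cfunspace_imp_mdist_le[of f X euclidean_metric g a x] that
    by (simp add: m_def dist_real_def)
  define A where "A k = {f \<in> mspace m. \<forall>N. (\<Sum>n<N. \<bar>pairing (\<mu> n) f\<bar> powr q) \<le> real k}" for k :: nat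
  have closed: "closedin B.mtopology (A k)" for k
    unfolding B.metric_closedin_iff_sequentially_closed
  proof (intro conjI allI impI)
    fix s l assume *: "range s \<subseteq> A k \<and> limitin B.mtopology s l sequentially"
    then have l: "l \<in> mspace m" and s: "s i \<in> mspace m" for i
      by (auto simp: B.limitin_mspace A_def)
    have lim: "(\<lambda>i. mdist m (s i) l) \<longlonglongrightarrow> 0"
      using * by (simp add: B.limitin_metric_dist_null)
    have ptw: "(\<lambda>i. s i x) \<longlonglongrightarrow> l x" if "x \<in> topspace X" for x
    proof -
      have "(\<lambda>i. s i x - l x) \<longlonglongrightarrow> 0"
        by (rule Lim_null_comparison[OF _ lim]) (use le[OF s l order_refl that] in auto)
      then show ?thesis by (simp add: LIM_zero_iff)
    qed
    have "(\<lambda>i. pairing (\<mu> n) (s i)) \<longlonglongrightarrow> pairing (\<mu> n) l" for n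
      unfolding pairing_def by (intro tendsto_sum tendsto_mult tendsto_const ptw)
        (auto intro: support_in_space)
    then have "(\<lambda>i. \<bar>pairing (\<mu> n) (s i)\<bar> powr q) \<longlonglongrightarrow> \<bar>pairing (\<mu> n) l\<bar> powr q" for n
      using q_pos by (intro tendsto_powr' tendsto_rabs) auto
    then have "(\<lambda>i. \<Sum>n<N. \<bar>pairing (\<mu> n) (s i)\<bar> powr q) \<longlonglongrightarrow> (\<Sum>n<N. \<bar>pairing (\<mu> n) l\<bar> powr q)" for N
      by (intro tendsto_sum)
    then have "(\<Sum>n<N. \<bar>pairing (\<mu> n) l\<bar> powr q) \<le> real k" for N
      by (rule LIMSEQ_le_const2) (use * in \<open>auto simp: A_def\<close>)
    then show "l \<in> A k" using l by (simp add: A_def)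
  qed (auto simp: A_def)
  have cover: "\<Union>(range A) = mspace m"
  proof
    show "mspace m \<subseteq> \<Union>(range A)"
    proof
      fix f assume f: "f \<in> mspace m"
      then have sm: "summable (\<lambda>n. \<bar>pairing (\<mu> n) f\<bar> powr q)"
        using pairings_in_ell[of f] by (simp add: mspace ell_def)
      obtain k where k: "(\<Sum>n. \<bar>pairing (\<mu> n) f\<bar> powr q) \<le> real k"
        using real_arch_simple by blast
      have "f \<in> A k"
        using f k sum_le_suminf[OF sm] unfolding A_def by (auto intro: order_trans)
      then show "f \<in> \<Union>(range A)" by blast
    qed
  qed (auto simp: A_def)
  have "(\<lambda>x\<in>topspace X. 0) \<in> mspace m"
    by (auto simp: mspace intro: continuous_map_eq[of X _ "\<lambda>x. 0"] boundedI[of _ 0])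
  then have "B.mtopology interior_of \<Union>(range A) \<noteq> {}"
    using cover openin_topspace[of B.mtopology] by (metis B.topspace_mtopology empty_iff interior_of_openin)
  with B.metric_Baire_category_alt[OF complete, of "range A"] closed
  obtain k where "B.mtopology interior_of (A k) \<noteq> {}"
    by auto
  then obtain f0 where "f0 \<in> B.mtopology interior_of (A k)" by blast
  then obtain r where r: "r > 0" "B.mball f0 r \<subseteq> A k" and f0A: "f0 \<in> A k"
    by (meson B.openin_mtopology interior_of_subset openin_interior_of order_trans subsetD)
  then have f0: "f0 \<in> mspace m" by (simp add: A_def)
  show thesis
  proof (rule that)
    fix g N assume g: "continuous_map X euclideanreal g" "\<And>x. x \<in> topspace X \<Longrightarrow> \<bar>g x\<bar> \<le> 1"
    \<comment> \<open>The radius is halved because the ball is open.\<close>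
    define f1 where "f1 = (\<lambda>x\<in>topspace X. f0 x + r / 2 * g x)"
    have "f1 \<in> mspace m"
      unfolding mspace
    proof (intro conjI)
      have "continuous_map X euclideanreal (\<lambda>x. f0 x + r / 2 * g x)"
        by (rule continuous_map_add[OF _ continuous_map_real_mult_left[OF g(1)]]) (use f0 in \<open>simp add: mspace\<close>)
      then show "continuous_map X euclideanreal f1"
        by (rule continuous_map_eq) (simp add: f1_def)
      obtain b where b: "\<And>x. x \<in> topspace X \<Longrightarrow> \<bar>f0 x\<bar> \<le> b"
        using f0 by (auto simp: mspace bounded_iff)
      have "\<bar>f0 x + r / 2 * g x\<bar> \<le> b + r / 2" if "x \<in> topspace X" for x
      proof -
        have "\<bar>r / 2 * g x\<bar> \<le> r / 2"
          using g(2)[OF that] r by (simp add: abs_mult mult_left_le)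
        then show ?thesis using b[OF that] by linarith
      qed
      then show "bounded (f1 ` topspace X)"
        by (intro boundedI[of _ "b + r / 2"]) (auto simp: f1_def)
    qed (simp add: f1_def)
    moreover have "mdist m f0 f1 \<le> r / 2"
      unfolding m_def
      by (rule mdist_cfunspace_le) (use g r in \<open>auto simp: f1_def dist_real_def abs_mult mult_left_le\<close>)
    ultimately have f1: "f1 \<in> A k"
      using r f0 by (auto simp: subset_iff B.mball_def)
    have eq: "pairing (\<mu> n) g = 2 / r * (pairing (\<mu> n) f1 - pairing (\<mu> n) f0)" for n
    proof -
      have "pairing (\<mu> n) f1 = pairing (\<mu> n) (\<lambda>x. 1 * f0 x + r / 2 * g x)"
        by (rule pairing_cong) (auto simp: f1_def dest: support_in_space)
      then show ?thesis
        using r by (simp only: pairing_linear) (simp add: field_simps)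
    qed
    have "\<bar>pairing (\<mu> n) g\<bar> powr q \<le>
        (2 / r) powr q * (2 powr q * (\<bar>pairing (\<mu> n) f1\<bar> powr q + \<bar>pairing (\<mu> n) f0\<bar> powr q))" for n
      unfolding eq abs_mult using r
      by (auto simp: powr_mult powr_divide intro!: divide_right_mono mult_left_mono diff_powr_le)
    then have "(\<Sum>n<N. \<bar>pairing (\<mu> n) g\<bar> powr q) \<le>
        (\<Sum>n<N. (2 / r) powr q * (2 powr q * (\<bar>pairing (\<mu> n) f1\<bar> powr q + \<bar>pairing (\<mu> n) f0\<bar> powr q)))"
      by (rule sum_mono)
    also have "\<dots> = (2 / r) powr q * (2 powr q *
        ((\<Sum>n<N. \<bar>pairing (\<mu> n) f1\<bar> powr q) + (\<Sum>n<N. \<bar>pairing (\<mu> n) f0\<bar> powr q)))"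
      by (simp add: sum_distrib_left sum.distrib distrib_left)
    also have "\<dots> \<le> (2 / r) powr q * (2 powr q * (real k + real k))"
      using f1 f0A by (intro mult_left_mono add_mono) (auto simp: A_def)
    finally show "(\<Sum>n<N. \<bar>pairing (\<mu> n) g\<bar> powr q) \<le> (2 / r) powr q * (2 powr q * (real k + real k))" .
  qed
qed

lemma le_uniform_bound:
  fixes a :: "nat \<Rightarrow> real"
  assumes "\<And>N. (\<Sum>n<N. \<bar>a n\<bar> powr q) \<le> C" "finite J"
  shows "(\<Sum>n\<in>J. \<bar>a n\<bar> powr q) \<le> C"
proof -
  obtain N where "J \<subseteq> {..<N}"
    using finite_nat_iff_bounded[THEN iffD1, OF assms(2)] by blast
  then have "(\<Sum>n\<in>J. \<bar>a n\<bar> powr q) \<le> (\<Sum>n<N. \<bar>a n\<bar> powr q)"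
    by (intro sum_mono2) auto
  then show ?thesis using assms(1)[of N] by linarith
qed

text \<open>
  A continuous function that agrees with the indicator of \<open>x\<close> on the supports of the first \<open>N\<close>
  measures picks out their atoms at \<open>x\<close>.
\<close>

lemma atoms_uniformly_bounded:
  obtains C where "\<And>x N. (\<Sum>n<N. \<bar>\<mu> n x\<bar> powr q) \<le> C"
proof -
  obtain C where C: "\<And>g N. continuous_map X euclideanreal g \<Longrightarrow> (\<And>x. x \<in> topspace X \<Longrightarrow> \<bar>g x\<bar> \<le> 1)
    \<Longrightarrow> (\<Sum>n<N. \<bar>pairing (\<mu> n) g\<bar> powr q) \<le> C"
    using uniformly_bounded by blast
  show thesis
  proof (rule that)
    fix x N
    define F where "F = (\<Union>n<N. {y. \<mu> n y \<noteq> 0})"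
    have F: "finite F" "F \<subseteq> topspace X"
      using finite_support support_in_space by (auto simp: F_def)
    define v :: "'a \<Rightarrow> real" where "v y = (if y = x then 1 else 0)" for y
    obtain g where g: "continuous_map X euclideanreal g" "\<And>y. \<bar>g y\<bar> \<le> 1"
      "\<And>y. y \<in> F \<Longrightarrow> g y = v y"
      by (rule Tychonoff_finite_interpolation[OF Tychonoff F, of v]) (auto simp: v_def)
    have "pairing (\<mu> n) g = \<mu> n x" if "n < N" for n
    proof -
      have "pairing (\<mu> n) g = pairing (\<mu> n) v"
        by (rule pairing_cong, rule g(3)) (use that in \<open>auto simp: F_def\<close>)
      also have "\<dots> = \<mu> n x * v x"
        by (rule pairing_single[OF finite_support]) (simp add: v_def)
      finally show ?thesis by (simp add: v_def)
    qed
    then show "(\<Sum>n<N. \<bar>\<mu> n x\<bar> powr q) \<le> C"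
      using C[OF g(1,2), of N] by simp
  qed
qed

lemma atoms_tendsto_zero: "(\<lambda>n. \<mu> n x) \<longlonglongrightarrow> 0"
proof -
  obtain C where C: "\<And>x N. (\<Sum>n<N. \<bar>\<mu> n x\<bar> powr q) \<le> C"
    using atoms_uniformly_bounded by blast
  have "summable (\<lambda>n. \<bar>\<mu> n x\<bar> powr q)"
    by (rule bounded_imp_summable[of _ C]) (use C[of _ "Suc _"] in \<open>auto simp: lessThan_Suc_atMost\<close>)
  then have "(\<lambda>n. \<bar>\<mu> n x\<bar> powr q) \<longlonglongrightarrow> 0"
    by (rule summable_LIMSEQ_zero)
  then have "(\<lambda>n. (\<bar>\<mu> n x\<bar> powr q) powr (1 / q)) \<longlonglongrightarrow> 0 powr (1 / q)"
    using q_pos by (intro tendsto_powr' tendsto_const) auto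
  then show ?thesis
    using q_pos by (simp add: powr_powr tendsto_rabs_zero_iff)
qed

section \<open>Functional boundedness of the supports\<close>

lemma ell_measures_weighted:
  assumes "continuous_map X euclideanreal w"
  shows "ell_measures X q (\<lambda>n x. w x * \<mu> n x)"
proof
  show "finite {x. w x * \<mu> n x \<noteq> 0}" for n
    by (rule finite_subset[OF _ finite_support[of n]]) auto
  show "(\<lambda>n. pairing (\<lambda>x. w x * \<mu> n x) f) \<in> ell q" if "continuous_map X euclideanreal f" for f
    using pairings_in_ell[OF continuous_map_real_mult[OF assms that]]
    by (simp add: pairing_mult_measure[OF finite_support])
qed (use Tychonoff q_pos support_in_space in auto)

end

text \<open>
  A weighted sum of ramps, the \<open>i\<close>-th of which starts at \<open>i - 1\<close> and is at least \<open>1\<close> from \<open>i\<close> on. Only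
  finitely many of them are nonzero near a given point.
\<close>

lemma ex_continuous_dominating:
  fixes c :: "nat \<Rightarrow> real"
  assumes "\<And>m. 0 \<le> c m"
  obtains \<phi> :: "real \<Rightarrow> real" where "continuous_on UNIV \<phi>" "\<And>m t. real m \<le> t \<Longrightarrow> c m \<le> \<phi> t"
proof
  define \<phi> where "\<phi> t = (\<Sum>i < nat \<lceil>t + 1\<rceil>. c i * max 0 (t - real i + 1))" for t
  have eq: "\<phi> t = (\<Sum>i<K. c i * max 0 (t - real i + 1))" if "t + 1 \<le> real K" for t K
    unfolding \<phi>_def
  proof (rule sum.mono_neutral_left)
    show "{..<nat \<lceil>t + 1\<rceil>} \<subseteq> {..<K}" using that by (auto simp: nat_less_iff) linarith
    show "\<forall>i\<in>{..<K} - {..<nat \<lceil>t + 1\<rceil>}. c i * max 0 (t - real i + 1) = 0"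
    proof
      fix i assume "i \<in> {..<K} - {..<nat \<lceil>t + 1\<rceil>}"
      then have "nat \<lceil>t + 1\<rceil> \<le> i" by simp
      then have "t + 1 \<le> real i" by linarith
      then show "c i * max 0 (t - real i + 1) = 0" by simp
    qed
  qed simp
  show "continuous_on UNIV \<phi>"
  proof (rule continuous_at_imp_continuous_on, rule ballI)
    fix t :: real
    obtain K :: nat where K: "t + 2 \<le> real K" using real_arch_simple by blast
    have "isCont (\<lambda>t. \<Sum>i<K. c i * max 0 (t - real i + 1)) t"
      by (intro continuous_intros)
    moreover have "eventually (\<lambda>s. s < t + 1) (nhds t)"
      using eventually_nhds_in_open[of "{..<t+1}" t] by simp
    then have "eventually (\<lambda>s. \<phi> s = (\<Sum>i<K. c i * max 0 (s - real i + 1))) (nhds t)"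
      by eventually_elim (use K in \<open>auto intro: eq\<close>)
    ultimately show "isCont \<phi> t"
      by (simp add: isCont_cong)
  qed
  show "c m \<le> \<phi> t" if "real m \<le> t" for m t
  proof -
    obtain K :: nat where K: "t + 1 \<le> real K" using real_arch_simple by blast
    then have m: "m \<in> {..<K}" using that by simp
    have "c m \<le> c m * max 0 (t - real m + 1)"
      using that assms[of m] by (simp add: mult_le_cancel_left1)
    also have "\<dots> \<le> (\<Sum>i<K. c i * max 0 (t - real i + 1))"
      using assms by (intro member_le_sum[OF m]) auto
    finally show ?thesis using eq[OF K] by simp
  qed
qed

context ell_measures
begin

text \<open>
  Otherwise there are atoms \<open>x\<^sub>m\<close> of some measures with \<open>\<bar>f x\<^sub>m\<bar> > m\<close>. A weight \<open>w = \<phi> \<circ> \<bar>f\<bar>\<close> that grows fast enough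
  raises the \<open>m\<close>-th of these atoms to a mass of at least \<open>m\<close>, against the uniform bound for the
  atoms of the weighted measures.
\<close>

lemma bounded_on_supports:
  assumes f: "continuous_map X euclideanreal f"
  obtains M where "\<And>n x. \<mu> n x \<noteq> 0 \<Longrightarrow> \<bar>f x\<bar> \<le> M"
proof (rule ccontr)
  assume "\<not> thesis"
  then have "\<forall>m::nat. \<exists>p. \<mu> (fst p) (snd p) \<noteq> 0 \<and> real m < \<bar>f (snd p)\<bar>"
    using that by (metis fst_conv snd_conv not_le)
  then obtain p where p: "\<And>m::nat. \<mu> (fst (p m)) (snd (p m)) \<noteq> 0 \<and> real m < \<bar>f (snd (p m))\<bar>"
    by metis
  define c where "c m = real m / \<bar>\<mu> (fst (p m)) (snd (p m))\<bar>" for m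
  obtain \<phi> :: "real \<Rightarrow> real"
    where \<phi>: "continuous_on UNIV \<phi>" "\<And>m t. real m \<le> t \<Longrightarrow> c m \<le> \<phi> t"
    by (rule ex_continuous_dominating[of c]) (auto simp: c_def)
  define w where "w x = \<phi> \<bar>f x\<bar>" for x
  have "continuous_map X euclideanreal (\<phi> \<circ> (\<lambda>x. \<bar>f x\<bar>))"
    by (rule continuous_map_compose[OF continuous_map_real_abs[OF f]]) (use \<phi> in simp)
  then have "continuous_map X euclideanreal w"
    by (simp add: w_def[abs_def] o_def)
  then interpret W: ell_measures X q "\<lambda>n x. w x * \<mu> n x"
    by (rule ell_measures_weighted)
  obtain C where C: "\<And>x N. (\<Sum>n<N. \<bar>w x * \<mu> n x\<bar> powr q) \<le> C"
    using W.atoms_uniformly_bounded by blast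
  have bound: "real m powr q \<le> C" for m
  proof -
    have "c m \<le> w (snd (p m))"
      using p[of m] by (auto simp: w_def intro: \<phi>)
    then have "c m * \<bar>\<mu> (fst (p m)) (snd (p m))\<bar> \<le> w (snd (p m)) * \<bar>\<mu> (fst (p m)) (snd (p m))\<bar>"
      by (rule mult_right_mono) simp
    also have "\<dots> \<le> \<bar>w (snd (p m)) * \<mu> (fst (p m)) (snd (p m))\<bar>"
      by (simp add: abs_mult mult_right_mono)
    finally have "real m \<le> \<bar>w (snd (p m)) * \<mu> (fst (p m)) (snd (p m))\<bar>"
      using p[of m] by (simp add: c_def)
    then have "real m powr q \<le> \<bar>w (snd (p m)) * \<mu> (fst (p m)) (snd (p m))\<bar> powr q"
      using q_pos by (intro powr_mono2) auto
    also have "\<dots> \<le> C"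
      using W.le_uniform_bound[of "\<lambda>n. w (snd (p m)) * \<mu> n (snd (p m))" C "{fst (p m)}"] C by simp
    finally show ?thesis .
  qed
  have "0 \<le> C" using bound[of 0] q_pos by simp
  obtain m :: nat where "(C + 1) powr (1 / q) \<le> real m" using real_arch_simple by blast
  then have "((C + 1) powr (1 / q)) powr q \<le> real m powr q"
    using q_pos by (intro powr_mono2) auto
  then have "C + 1 \<le> real m powr q" using q_pos \<open>0 \<le> C\<close> by (simp add: powr_powr)
  then show False using bound[of m] by linarith
qed

section \<open>Variations bounded away from zero\<close>

lemma variation_eventually_ge:
  assumes onto: "\<And>y. y \<in> ell q \<Longrightarrow> \<exists>f. continuous_map X euclideanreal f \<and> (\<forall>n. pairing (\<mu> n) f = y n)"
  shows "\<exists>c>0. \<exists>K. \<forall>n\<ge>K. c \<le> variation (\<mu> n)"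
proof (rule ccontr)
  assume none: "\<not> ?thesis"
  have small: "\<exists>n\<ge>K. variation (\<mu> n) < c" if "0 < c" for c K
  proof -
    from none that have "\<not> (\<forall>n\<ge>K. c \<le> variation (\<mu> n))" by blast
    then show ?thesis by (simp add: not_le)
  qed
  have "\<exists>r. \<forall>k. variation (\<mu> (r k)) < (1/4) ^ k \<and> r k < r (Suc k)"
  proof (rule dependent_nat_choice)
    show "\<exists>n. variation (\<mu> n) < (1/4) ^ 0" using small[of 1 0] by auto
    show "\<exists>n'. variation (\<mu> n') < (1/4) ^ Suc k \<and> n < n'" for n k
      using small[of "(1/4) ^ Suc k" "Suc n"] by auto
  qed
  then obtain r where r: "\<And>k. variation (\<mu> (r k)) < (1/4) ^ k" "\<And>k. r k < r (Suc k)"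
    by blast
  have mono: "strict_mono r" using r(2) by (simp add: strict_mono_Suc_iff)
  then have inj: "inj r" by (rule strict_mono_imp_inj_on)
  \<comment> \<open>A sequence that decays slower than the variations along \<open>r\<close>, but still geometrically, so that it lies in \<open>ell q\<close> for every \<open>q\<close>.\<close>
  define y where "y n = (if n \<in> range r then (1/2) ^ inv r n else 0 :: real)" for n
  have y: "y (r k) = (1/2) ^ k" for k
    by (simp add: y_def inv_f_f[OF inj])
  have "\<bar>y (r k)\<bar> powr q = ((1/2) powr q) ^ k" for k
    by (simp add: y powr_realpow[symmetric] powr_powr mult.commute)
  moreover have "(1/2::real) powr q < 1" using q_pos powr_less_mono2[of q "1/2" 1] by simp
  ultimately have "summable (\<lambda>k. \<bar>y (r k)\<bar> powr q)"
    by (simp add: summable_geometric)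
  then have "y \<in> ell q"
    using summable_mono_reindex[OF mono, of "\<lambda>n. \<bar>y n\<bar> powr q"] by (simp add: ell_def y_def)
  then obtain f where f: "continuous_map X euclideanreal f" "\<And>n. pairing (\<mu> n) f = y n"
    using onto by blast
  obtain M where M: "\<And>n x. \<mu> n x \<noteq> 0 \<Longrightarrow> \<bar>f x\<bar> \<le> M"
    using bounded_on_supports[OF f(1)] by blast
  have "2 ^ k \<le> max M 1" for k :: nat
  proof -
    have "(1/2) ^ k \<le> variation (\<mu> (r k)) * max M 1"
      using abs_pairing_le[of "\<mu> (r k)" f "max M 1"] M by (force simp: f y)
    also have "\<dots> \<le> (1/4) ^ k * max M 1"
      using r(1)[of k] by (intro mult_right_mono) auto
    finally have "4 ^ k * (1/2) ^ k \<le> max M 1"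
      by (simp add: field_simps power_divide)
    then show ?thesis by (simp flip: power_mult_distrib)
  qed
  moreover obtain k :: nat where "max M 1 < 2 ^ k"
    using real_arch_pow[of 2 "max M 1"] by (auto simp del: max_less_iff_conj)
  ultimately show False by (metis not_le)
qed

section \<open>Almost disjoint measures\<close>

text \<open>
  A gliding hump of finite length. Given \<open>v\<close> for the set \<open>J\<close> of measures, whose supports have union \<open>G\<close>, take a measure so
  late that it has mass below \<open>c / 4\<close> on \<open>G\<close>. Redefining \<open>v\<close> outside \<open>G\<close> as the sign of the new
  measure does not change the earlier pairings, and the new pairing misses the variation
  by at most twice the mass on \<open>G\<close>. Continuity of the function enters afterwards, by interpolating
  the values of \<open>v\<close> on the finite supports.
\<close>

lemma simultaneous_norming:
  assumes c: "0 < c" "\<forall>n\<ge>K. c \<le> variation (\<mu> n)"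
  shows "\<exists>J v. finite J \<and> card J = N \<and> (\<forall>x. \<bar>v x\<bar> \<le> 1) \<and> (\<forall>n\<in>J. c / 2 \<le> pairing (\<mu> n) v)"
proof (induction N)
  case 0
  then show ?case by (intro exI[of _ "{}"] exI[of _ "\<lambda>_. 0"]) auto
next
  case (Suc N)
  then obtain J v where J: "finite J" "card J = N" and v: "\<And>x. \<bar>v x\<bar> \<le> 1"
    and n: "\<And>n. n \<in> J \<Longrightarrow> c / 2 \<le> pairing (\<mu> n) v"
    by blast
  define G where "G = (\<Union>n\<in>J. {x. \<mu> n x \<noteq> 0})"
  have G: "finite G" using J finite_support by (auto simp: G_def)
  have "(\<lambda>n. \<Sum>x\<in>G. \<bar>\<mu> n x\<bar>) \<longlonglongrightarrow> 0"
    using atoms_tendsto_zero by (intro tendsto_null_sum tendsto_rabs_zero)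
  then have "eventually (\<lambda>n. (\<Sum>x\<in>G. \<bar>\<mu> n x\<bar>) < c / 4) sequentially"
    by (rule order_tendstoD) (use c(1) in simp)
  then obtain K' where K': "\<And>n. K' \<le> n \<Longrightarrow> (\<Sum>x\<in>G. \<bar>\<mu> n x\<bar>) < c / 4"
    by (auto simp: eventually_sequentially)
  obtain L where L: "J \<subseteq> {..<L}" using finite_nat_iff_bounded[THEN iffD1, OF J(1)] by blast
  define l where "l = max L (max K K')"
  have l: "l \<notin> J" "c \<le> variation (\<mu> l)" "(\<Sum>x\<in>G. \<bar>\<mu> l x\<bar>) < c / 4"
    using L c(2) K' by (auto simp: l_def)
  define u where "u x = (if x \<in> G then v x else sgn (\<mu> l x))" for x
  have u: "\<bar>u x\<bar> \<le> 1" for x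
    using v by (auto simp: u_def sgn_if)
  have "c / 2 \<le> pairing (\<mu> n) u" if "n \<in> J" for n
  proof -
    have "pairing (\<mu> n) u = pairing (\<mu> n) v"
      by (rule pairing_cong) (use that in \<open>auto simp: u_def G_def\<close>)
    then show ?thesis using n[OF that] by simp
  qed
  moreover have "c / 2 \<le> pairing (\<mu> l) u"
  proof -
    define S where "S = {x. \<mu> l x \<noteq> 0}"
    have S: "finite S" using finite_support by (simp add: S_def)
    have "variation (\<mu> l) - pairing (\<mu> l) u = (\<Sum>x\<in>S. \<bar>\<mu> l x\<bar> - \<mu> l x * u x)"
      by (simp add: variation_def pairing_def S_def sum_subtractf)
    also have "\<dots> = (\<Sum>x\<in>S \<inter> G. \<bar>\<mu> l x\<bar> - \<mu> l x * u x)"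
      by (rule sum.mono_neutral_right) (use S in \<open>auto simp: u_def abs_sgn\<close>)
    also have "\<dots> \<le> (\<Sum>x\<in>S \<inter> G. 2 * \<bar>\<mu> l x\<bar>)"
    proof (rule sum_mono)
      fix x
      have "\<bar>\<mu> l x * u x\<bar> \<le> \<bar>\<mu> l x\<bar>" using u[of x] by (simp add: abs_mult mult_left_le)
      then show "\<bar>\<mu> l x\<bar> - \<mu> l x * u x \<le> 2 * \<bar>\<mu> l x\<bar>" by linarith
    qed
    also have "\<dots> \<le> (\<Sum>x\<in>G. 2 * \<bar>\<mu> l x\<bar>)"
      using G by (intro sum_mono2) auto
    also have "\<dots> \<le> c / 2" using l(3) by (simp flip: sum_distrib_left)
    finally show ?thesis using l(2) by linarith
  qed
  ultimately show ?case
    using J l(1) u by (intro exI[of _ "insert l J"] exI[of _ u]) auto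
qed

theorem not_onto_ell:
  "\<not> (\<forall>y \<in> ell q. \<exists>f. continuous_map X euclideanreal f \<and> (\<forall>n. pairing (\<mu> n) f = y n))"
proof
  assume onto: "\<forall>y \<in> ell q. \<exists>f. continuous_map X euclideanreal f \<and> (\<forall>n. pairing (\<mu> n) f = y n)"
  obtain c K where c: "0 < c" "\<forall>n\<ge>K. c \<le> variation (\<mu> n)"
    using variation_eventually_ge onto by blast
  obtain C where C: "\<And>g N. continuous_map X euclideanreal g \<Longrightarrow> (\<And>x. x \<in> topspace X \<Longrightarrow> \<bar>g x\<bar> \<le> 1)
    \<Longrightarrow> (\<Sum>n<N. \<bar>pairing (\<mu> n) g\<bar> powr q) \<le> C"
    using uniformly_bounded by blast
  have bound: "real N * (c / 2) powr q \<le> C" for N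
  proof -
    from simultaneous_norming[OF c, of N] obtain J v where
      "finite J \<and> card J = N \<and> (\<forall>x. \<bar>v x\<bar> \<le> 1) \<and> (\<forall>n\<in>J. c / 2 \<le> pairing (\<mu> n) v)"
      by (elim exE)
    then have J: "finite J" "card J = N" and v: "\<And>x. \<bar>v x\<bar> \<le> 1"
      and n: "\<And>n. n \<in> J \<Longrightarrow> c / 2 \<le> pairing (\<mu> n) v"
      by simp_all
    define G where "G = (\<Union>n\<in>J. {x. \<mu> n x \<noteq> 0})"
    have G: "finite G" "G \<subseteq> topspace X"
      using J finite_support support_in_space by (auto simp: G_def)
    obtain g where g: "continuous_map X euclideanreal g" "\<And>x. \<bar>g x\<bar> \<le> 1" "\<And>x. x \<in> G \<Longrightarrow> g x = v x"
      by (rule Tychonoff_finite_interpolation[OF Tychonoff G, of v]) (use v in auto)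
    have "(c / 2) powr q \<le> \<bar>pairing (\<mu> n) g\<bar> powr q" if "n \<in> J" for n
    proof -
      have "pairing (\<mu> n) g = pairing (\<mu> n) v"
        by (rule pairing_cong) (use that g(3) in \<open>auto simp: G_def\<close>)
      then show ?thesis
        using n[OF that] c(1) q_pos by (intro powr_mono2) auto
    qed
    then have "(\<Sum>n\<in>J. (c / 2) powr q) \<le> (\<Sum>n\<in>J. \<bar>pairing (\<mu> n) g\<bar> powr q)"
      by (rule sum_mono)
    also have "\<dots> \<le> C"
      by (rule le_uniform_bound[OF _ J(1)]) (use C[OF g(1,2)] in auto)
    finally show ?thesis using J by simp
  qed
  obtain N :: nat where "C < real N * (c / 2) powr q"
    using ex_less_of_nat_mult[of "(c / 2) powr q" C] c(1) by auto
  then show False using bound[of N] by linarith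
qed

end

section \<open>Continuous functionals are finitely supported\<close>

text \<open>
  A basic neighbourhood of \<open>0\<close> on which \<open>\<bar>L\<bar> < 1\<close> restricts only finitely many coordinates. All multiples
  of a function that vanishes at these coordinates lie in it, so \<open>L\<close> vanishes at that function.
\<close>

lemma Cp_functional_finitely_determined:
  assumes cont: "continuous_map (Cp X) euclideanreal L"
    and scale: "\<And>c f. f \<in> topspace (Cp X) \<Longrightarrow> L (pointwise_scale (topspace X) c f) = c * L f"
  obtains F where "finite F" "F \<subseteq> topspace X"
    "\<And>f. f \<in> topspace (Cp X) \<Longrightarrow> (\<And>x. x \<in> F \<Longrightarrow> f x = 0) \<Longrightarrow> L f = 0"
proof -
  define z where "z = (\<lambda>x\<in>topspace X. 0 :: real)"
  have z: "z \<in> topspace (Cp X)"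
    by (auto simp: topspace_Cp z_def intro: continuous_map_eq[of X _ "\<lambda>x. 0"])
  have Lz: "L z = 0"
    using scale[OF z, of 0] by (simp add: z_def pointwise_scale_def restrict_def cong: if_cong)
  have "openin (Cp X) {f \<in> topspace (Cp X). L f \<in> {-1<..<1}}"
    using cont by (rule openin_continuous_map_preimage) simp
  then obtain W where W: "openin (powertop_real (topspace X)) W"
    "{f \<in> topspace (Cp X). L f \<in> {-1<..<1}} = W \<inter> {f. continuous_map X euclideanreal f}"
    unfolding Cp_def openin_subtopology by blast
  have "z \<in> {f \<in> topspace (Cp X). L f \<in> {-1<..<1}}" using z Lz by simp
  then have "z \<in> W" unfolding W(2) by simp
  then obtain U where U: "finite {x \<in> topspace X. U x \<noteq> UNIV}" "z \<in> Pi\<^sub>E (topspace X) U"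
    "Pi\<^sub>E (topspace X) U \<subseteq> W"
    using W(1)[unfolded openin_product_topology_alt, rule_format, of z] by auto
  show thesis
  proof (rule that[OF U(1)])
    fix f assume f: "f \<in> topspace (Cp X)" and f0: "\<And>x. x \<in> {x \<in> topspace X. U x \<noteq> UNIV} \<Longrightarrow> f x = 0"
    have small: "\<bar>c * L f\<bar> < 1" for c
    proof -
      have "pointwise_scale (topspace X) c f \<in> Pi\<^sub>E (topspace X) U"
        using U(2) f0 by (fastforce simp: pointwise_scale_def z_def PiE_iff)
      then have "pointwise_scale (topspace X) c f \<in> W \<inter> {f. continuous_map X euclideanreal f}"
        using U(3) pointwise_scale_Cp[OF f, of c] by (auto simp: topspace_Cp)
      then show ?thesis
        unfolding W(2)[symmetric] using scale[OF f, of c] by auto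
    qed
    show "L f = 0"
      using small[of "1 / L f"] by (cases "L f = 0") auto
  qed auto
qed

lemma Cp_functional_eq_pairing:
  assumes X: "Tychonoff_space X"
    and cont: "continuous_map (Cp X) euclideanreal L"
    and add: "\<And>f g. f \<in> topspace (Cp X) \<Longrightarrow> g \<in> topspace (Cp X)
      \<Longrightarrow> L (pointwise_add (topspace X) f g) = L f + L g"
    and scale: "\<And>c f. f \<in> topspace (Cp X) \<Longrightarrow> L (pointwise_scale (topspace X) c f) = c * L f"
  obtains \<mu> where "finite {x. \<mu> x \<noteq> 0}" "{x. \<mu> x \<noteq> 0} \<subseteq> topspace X"
    "\<And>f. f \<in> topspace (Cp X) \<Longrightarrow> L f = pairing \<mu> f"
proof -
  obtain F where F: "finite F" "F \<subseteq> topspace X"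
    "\<And>f. f \<in> topspace (Cp X) \<Longrightarrow> (\<And>x. x \<in> F \<Longrightarrow> f x = 0) \<Longrightarrow> L f = 0"
    using Cp_functional_finitely_determined[OF cont scale] by blast
  have "\<exists>h. h \<in> topspace (Cp X) \<and> (\<forall>y\<in>F. h y = (if y = x then 1 else 0))" if x: "x \<in> F" for x
  proof (rule Tychonoff_peak[OF X F(1,2)])
    show "x \<in> topspace X" using x F(2) by auto
    fix h assume h: "continuous_map X euclideanreal h" "h x = 1" "\<And>y. y \<in> F - {x} \<Longrightarrow> h y = 0"
    have "restrict h (topspace X) \<in> topspace (Cp X)"
      using h by (auto simp: topspace_Cp intro: continuous_map_eq)
    then show ?thesis
      using h F(2) by (intro exI[of _ "restrict h (topspace X)"]) auto
  qed
  then obtain h where h: "\<And>x. x \<in> F \<Longrightarrow> h x \<in> topspace (Cp X)"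
    "\<And>x y. x \<in> F \<Longrightarrow> y \<in> F \<Longrightarrow> h x y = (if y = x then 1 else 0)"
    by metis
  \<comment> \<open>Subtracting the multiples of the dual functions \<open>h x\<close> one point at a time leaves, for \<open>S = F\<close>, a function that vanishes on \<open>F\<close>.\<close>
  have subtract: "\<exists>g \<in> topspace (Cp X). (\<forall>x\<in>F. g x = f x - (if x \<in> S then f x else 0)) \<and>
      L g = L f - (\<Sum>x\<in>S. L (h x) * f x)" if f: "f \<in> topspace (Cp X)" and S: "finite S" "S \<subseteq> F" for f S
    using S
  proof (induction S)
    case empty
    then show ?case using f by auto
  next
    case (insert a S)
    then obtain g where g: "g \<in> topspace (Cp X)" "\<And>x. x \<in> F \<Longrightarrow> g x = f x - (if x \<in> S then f x else 0)"
      "L g = L f - (\<Sum>x\<in>S. L (h x) * f x)"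
      by auto
    define k where "k = pointwise_scale (topspace X) (- f a) (h a)"
    have a: "a \<in> F" using insert by auto
    have k: "k \<in> topspace (Cp X)" unfolding k_def by (rule pointwise_scale_Cp[OF h(1)[OF a]])
    show ?case
    proof (intro bexI[of _ "pointwise_add (topspace X) g k"] conjI ballI)
      show "pointwise_add (topspace X) g k \<in> topspace (Cp X)"
        by (rule pointwise_add_Cp[OF g(1) k])
      show "L (pointwise_add (topspace X) g k) = L f - (\<Sum>x\<in>insert a S. L (h x) * f x)"
        using insert add[OF g(1) k] g(3) scale[OF h(1)[OF a], of "- f a"] by (simp add: k_def)
      fix x assume x: "x \<in> F"
      then show "pointwise_add (topspace X) g k x = f x - (if x \<in> insert a S then f x else 0)"
        using F(2) g(2)[OF x] h(2)[OF a x] insert by (auto simp: pointwise_add_def pointwise_scale_def k_def)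
    qed
  qed
  define \<mu> where "\<mu> x = (if x \<in> F then L (h x) else 0)" for x
  have sub: "{x. \<mu> x \<noteq> 0} \<subseteq> F" by (auto simp: \<mu>_def)
  show thesis
  proof (rule that)
    show "finite {x. \<mu> x \<noteq> 0}" "{x. \<mu> x \<noteq> 0} \<subseteq> topspace X"
      using sub F finite_subset by auto
    fix f assume f: "f \<in> topspace (Cp X)"
    have "L f = (\<Sum>x\<in>F. L (h x) * f x)"
      using subtract[OF f F(1) order_refl] F(3) by fastforce
    also have "\<dots> = pairing \<mu> f"
      by (simp add: pairing_superset[OF F(1) sub] \<mu>_def)
    finally show "L f = pairing \<mu> f" .
  qed
qed

theorem corollary1p2:
  fixes X :: "'a topology" and q :: real
  assumes "Tychonoff_space X" and "0 < q"
  shows "\<nexists>T :: ('a \<Rightarrow> real) \<Rightarrow> (nat \<Rightarrow> real).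
           continuous_map (Cp X) (ell_p q) T \<and>
           pointwise_linear_on (topspace X) (topspace (Cp X)) UNIV T \<and>
           T ` topspace (Cp X) = topspace (ell_p q)"
proof
  assume "\<exists>T :: ('a \<Rightarrow> real) \<Rightarrow> (nat \<Rightarrow> real).
           continuous_map (Cp X) (ell_p q) T \<and>
           pointwise_linear_on (topspace X) (topspace (Cp X)) UNIV T \<and>
           T ` topspace (Cp X) = topspace (ell_p q)"
  then obtain T :: "('a \<Rightarrow> real) \<Rightarrow> (nat \<Rightarrow> real)"
    where cont: "continuous_map (Cp X) (ell_p q) T"
      and lin: "pointwise_linear_on (topspace X) (topspace (Cp X)) UNIV T"
      and onto: "T ` topspace (Cp X) = ell q"
    by (auto simp: topspace_ell_p)
  have "\<exists>\<mu>. finite {x. \<mu> x \<noteq> 0} \<and> {x. \<mu> x \<noteq> 0} \<subseteq> topspace X \<and>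
      (\<forall>f \<in> topspace (Cp X). T f n = pairing \<mu> f)" for n
  proof -
    have "continuous_map (Cp X) euclideanreal (\<lambda>f. T f n)"
      using cont by (auto simp: ell_p_def continuous_map_in_subtopology continuous_map_componentwise_UNIV)
    then show ?thesis
      by (rule Cp_functional_eq_pairing[OF assms(1)])
        (use lin in \<open>auto simp: pointwise_linear_on_def pointwise_add_def pointwise_scale_def\<close>)
  qed
  then obtain \<mu> where \<mu>: "\<And>n. finite {x. \<mu> n x \<noteq> 0}" "\<And>n. {x. \<mu> n x \<noteq> 0} \<subseteq> topspace X"
    "\<And>n f. f \<in> topspace (Cp X) \<Longrightarrow> T f n = pairing (\<mu> n) f"
    by metis
  interpret ell_measures X q \<mu>
  proof
    fix f assume "continuous_map X euclideanreal f"
    then have f: "restrict f (topspace X) \<in> topspace (Cp X)"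
      by (auto simp: topspace_Cp intro: continuous_map_eq)
    have "pairing (\<mu> n) f = T (restrict f (topspace X)) n" for n
      unfolding \<mu>(3)[OF f] by (rule pairing_cong) (use \<mu>(2)[of n] in auto)
    then show "(\<lambda>n. pairing (\<mu> n) f) \<in> ell q"
      using onto f by auto
  qed (use assms \<mu> in auto)
  have "\<exists>f. continuous_map X euclideanreal f \<and> (\<forall>n. pairing (\<mu> n) f = y n)" if y: "y \<in> ell q" for y
  proof -
    from y onto obtain f where "f \<in> topspace (Cp X)" "y = T f" by blast
    then show ?thesis using \<mu>(3) by (auto simp: topspace_Cp)
  qed
  then show False using not_onto_ell by blast
qed

end
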